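(* Let $\mathcal{A}$ be a randomized leader election algorithm in the $\mathsf{No}\text{-}\mathsf{CD}$ model that works for an unknown number $n \geq 2$ of devices. Write $T(n)$ and $E(n)$ for the expected time and expected energy complexities of $\mathcal{A}$ when run on $n$ devices. Suppose there is some integer $n^\ast \geq 2$ such that $T(n^\ast)$ is finite. Then there exist infinitely many network sizes $n$ such that $E(n) = \Omega(\log \log n)$.
   Context: Model: $n$ devices are connected to a multiple-access channel. Communication proceeds in synchronous rounds with a common time zero; in each round each device either transmits a message, listens to the channel, or stays idle. In the $\mathsf{No}\text{-}\mathsf{CD}$ model, transmitters receive no feedback, and a listener receives the message $m$ if exactly one device transmits in that round, and otherwise (zero or at least two transmitters) receives silence. In the randomized setting devices are anonymous, all run the same algorithm, and each has private random bits. Leader election: exactly one device must identify itself as the leader and all others as non-leaders; the protocol ends when the leader sends a message while every non-leader listens, so all devices terminate in the same round. The number of devices $n$ is unknown to the devices. Time complexity is the number of rounds; the energy cost of a device is its number of non-idle (transmitting or listening) rounds, and the energy complexity is the maximum energy cost over all devices. *)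

theory Defs
  imports "HOL-Probability.Probability"
begin

type_synonym msg = "bool list"

datatype action = Idle | Listen | Transmit msg

datatype role = Leader | NonLeader

text \<open>The private random bits of one device.\<close>

type_synonym bits = "nat \<Rightarrow> bool"

text \<open>
  What a device has got from the channel so far, one entry per completed round: \<open>Some m\<close> if it
  received the message \<open>m\<close>, and \<open>None\<close> otherwise. A device can reconstruct its own past actions
  from its bits and the earlier entries, so it knows whether a \<open>None\<close> was a silence it listened
  to or a round in which it did not listen.
\<close>

type_synonym view = "msg option list"

text \<open>
  The devices are anonymous, so one protocol is run by all of them, and \<open>n\<close> is not an input.
  \<open>act P b h\<close> is the action in the next round. \<open>verdict P b h = Some r\<close> means that a device with
  view \<open>h\<close> terminates, identifying itself as \<open>r\<close>.
\<close>

record protocol =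
  act :: "bits \<Rightarrow> view \<Rightarrow> action"
  verdict :: "bits \<Rightarrow> view \<Rightarrow> role option"

definition terminated :: "protocol \<Rightarrow> bits \<Rightarrow> view \<Rightarrow> bool" where
  "terminated P b h \<longleftrightarrow> (\<exists>s\<le>length h. verdict P b (take s h) \<noteq> None)"

definition action_of :: "protocol \<Rightarrow> bits \<Rightarrow> view \<Rightarrow> action" where
  "action_of P b h = (if terminated P b h then Idle else act P b h)"

text \<open>The \<open>No-CD\<close> channel with devices \<open>0, \<dots>, n - 1\<close>, where device \<open>j\<close> performs \<open>a j\<close>.\<close>

definition feedback :: "nat \<Rightarrow> (nat \<Rightarrow> action) \<Rightarrow> nat \<Rightarrow> msg option" where
  "feedback n a i =
     (if a i = Listen \<and> (\<exists>!j. j < n \<and> (\<exists>m. a j = Transmit m))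
      then Some (THE m. \<exists>j<n. a j = Transmit m)
      else None)"

text \<open>
  In a run, \<open>\<omega> i\<close> are the bits of device \<open>i\<close>. Rounds are numbered from \<open>0\<close>, and
  \<open>view_at P n \<omega> t i\<close> is the view of device \<open>i\<close> after rounds \<open>0, \<dots>, t - 1\<close>.
\<close>

primrec view_at :: "protocol \<Rightarrow> nat \<Rightarrow> (nat \<Rightarrow> bits) \<Rightarrow> nat \<Rightarrow> nat \<Rightarrow> view" where
  "view_at P n \<omega> 0 = (\<lambda>i. [])"
| "view_at P n \<omega> (Suc t) =
     (\<lambda>i. view_at P n \<omega> t i @ [feedback n (\<lambda>j. action_of P (\<omega> j) (view_at P n \<omega> t j)) i])"

definition action_at :: "protocol \<Rightarrow> nat \<Rightarrow> (nat \<Rightarrow> bits) \<Rightarrow> nat \<Rightarrow> nat \<Rightarrow> action" where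
  "action_at P n \<omega> t i = action_of P (\<omega> i) (view_at P n \<omega> t i)"

text \<open>
  The run ends correctly with round \<open>t\<close>. Since terminated devices are idle, the conditions on the
  actions in round \<open>t\<close> imply that no device has terminated earlier.
\<close>

definition elects_at :: "protocol \<Rightarrow> nat \<Rightarrow> (nat \<Rightarrow> bits) \<Rightarrow> nat \<Rightarrow> bool" where
  "elects_at P n \<omega> t \<longleftrightarrow>
     (\<exists>l<n. (\<exists>m. action_at P n \<omega> t l = Transmit m) \<and>
            verdict P (\<omega> l) (view_at P n \<omega> (Suc t) l) = Some Leader \<and>
            (\<forall>i<n. i \<noteq> l \<longrightarrow>
               action_at P n \<omega> t i = Listen \<and>
               verdict P (\<omega> i) (view_at P n \<omega> (Suc t) i) = Some NonLeader))"

definition run_time :: "protocol \<Rightarrow> nat \<Rightarrow> (nat \<Rightarrow> bits) \<Rightarrow> ennreal" where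
  "run_time P n \<omega> =
     (INF t\<in>{t. \<forall>i<n. terminated P (\<omega> i) (view_at P n \<omega> t i)}. of_nat t)"

definition device_energy :: "protocol \<Rightarrow> nat \<Rightarrow> (nat \<Rightarrow> bits) \<Rightarrow> nat \<Rightarrow> ennreal" where
  "device_energy P n \<omega> i = (\<Sum>t. if action_at P n \<omega> t i = Idle then 0 else 1)"

definition run_energy :: "protocol \<Rightarrow> nat \<Rightarrow> (nat \<Rightarrow> bits) \<Rightarrow> ennreal" where
  "run_energy P n \<omega> = (SUP i\<in>{..<n}. device_energy P n \<omega> i)"

definition coin_flips :: "bits measure" where
  "coin_flips = PiM UNIV (\<lambda>_. measure_pmf (bernoulli_pmf (1/2)))"

definition runs :: "nat \<Rightarrow> (nat \<Rightarrow> bits) measure" where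
  "runs n = PiM {..<n} (\<lambda>_. coin_flips)"

definition measurable_protocol :: "protocol \<Rightarrow> bool" where
  "measurable_protocol P \<longleftrightarrow>
     (\<forall>h. (\<lambda>b. act P b h) \<in> measurable coin_flips (count_space UNIV) \<and>
          (\<lambda>b. verdict P b h) \<in> measurable coin_flips (count_space UNIV))"

definition solves_leader_election :: "protocol \<Rightarrow> nat \<Rightarrow> bool" where
  "solves_leader_election P n \<longleftrightarrow> (AE \<omega> in runs n. \<exists>t. elects_at P n \<omega> t)"

definition expected_time :: "protocol \<Rightarrow> nat \<Rightarrow> ennreal" where
  "expected_time P n = (\<integral>\<^sup>+ \<omega>. run_time P n \<omega> \<partial>runs n)"

definition expected_energy :: "protocol \<Rightarrow> nat \<Rightarrow> ennreal" where
  "expected_energy P n = (\<integral>\<^sup>+ \<omega>. run_energy P n \<omega> \<partial>runs n)"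

end

theory Submission
  imports Defs
begin

text \<open>
  As long as nothing is received, the devices act independently, each according to its strategy
  on silent views. Fix \<open>t\<close> and let \<open>h\<close> be the number of non-idle rounds below \<open>t\<close> of such a
  strategy.

  As in Hansel's lemma on coverings by bipartite graphs, forbid in each round either transmitting
  or listening, by a fair coin: a device respects the prohibitions with probability
  \<open>w = E[2 ^ (- h)]\<close> on average over the coins, and \<open>n\<^sup>*\<close> devices that respect them receive
  nothing. So \<open>T(n\<^sup>*) \<ge> t * w ^ n\<^sup>*\<close>; hence \<open>w\<close> is polynomially small in \<open>t\<close>, and \<open>h\<close> is
  \<open>\<Omega>(log t)\<close> with probability at least \<open>3/4\<close>.

  On the other hand, if a device transmits with probability \<open>p\<close>, the probabilities of exactly one
  transmitter among \<open>2 ^ k\<close> devices sum over all \<open>k \<ge> 1\<close> to at most \<open>2\<close>. Averaging over \<open>8 * t\<close>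
  consecutive values of \<open>k\<close> yields \<open>k \<le> 16 * t\<close> such that \<open>2 ^ k\<close> devices receive nothing in the
  first \<open>t\<close> rounds with probability at least \<open>3/4\<close>. So the expected energy is \<open>\<Omega>(log t)\<close>, which
  is \<open>\<Omega>(log log (2 ^ k))\<close>.
\<close>

section \<open>Runs in which nothing is received\<close>

definition quiet_action :: "protocol \<Rightarrow> nat \<Rightarrow> bits \<Rightarrow> action" where
  "quiet_action P s b = action_of P b (replicate s None)"

definition quiet_energy :: "protocol \<Rightarrow> nat \<Rightarrow> bits \<Rightarrow> nat" where
  "quiet_energy P t b = card {s. s < t \<and> quiet_action P s b \<noteq> Idle}"

definition transmitting :: "protocol \<Rightarrow> nat \<Rightarrow> bits set" where
  "transmitting P s = {b. \<exists>m. quiet_action P s b = Transmit m}"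

definition listening :: "protocol \<Rightarrow> nat \<Rightarrow> bits set" where
  "listening P s = {b. quiet_action P s b = Listen}"

lemma feedback_eq_None_iff:
  "feedback n a i = None \<longleftrightarrow> \<not> (a i = Listen \<and> (\<exists>!j. j < n \<and> (\<exists>m. a j = Transmit m)))"
  by (auto simp: feedback_def)

lemma feedback_cong:
  assumes "\<And>j. j < n \<Longrightarrow> a j = a' j" "i < n"
  shows "feedback n a i = feedback n a' i"
proof -
  have "(\<exists>!j. j < n \<and> (\<exists>m. a j = Transmit m)) \<longleftrightarrow> (\<exists>!j. j < n \<and> (\<exists>m. a' j = Transmit m))"
    using assms(1) by metis
  moreover have "(\<exists>j<n. a j = Transmit m) \<longleftrightarrow> (\<exists>j<n. a' j = Transmit m)" for m
    using assms(1) by metis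
  ultimately show ?thesis
    using assms by (simp add: feedback_def)
qed

text \<open>Stated through \<open>quiet_action\<close> instead of the real views: the condition then
  depends on the devices only through strategies that do not interact, which makes independence
  usable. \<open>view_at_quiet\<close> links it to the real run.\<close>

definition stays_quiet :: "protocol \<Rightarrow> nat \<Rightarrow> (nat \<Rightarrow> bits) \<Rightarrow> nat \<Rightarrow> bool" where
  "stays_quiet P n \<omega> t \<longleftrightarrow>
     (\<forall>s<t. \<forall>i<n. feedback n (\<lambda>j. quiet_action P s (\<omega> j)) i = None)"

lemma view_at_quiet:
  assumes "stays_quiet P n \<omega> t" "s \<le> t" "i < n"
  shows "view_at P n \<omega> s i = replicate s None"
  using assms(2,3)
proof (induction s arbitrary: i)
  case (Suc s)
  have "feedback n (\<lambda>j. action_of P (\<omega> j) (view_at P n \<omega> s j)) i =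
        feedback n (\<lambda>j. quiet_action P s (\<omega> j)) i"
    using Suc by (intro feedback_cong) (auto simp: quiet_action_def)
  also have "\<dots> = None"
    using assms(1) Suc.prems by (auto simp: stays_quiet_def)
  finally show ?case
    using Suc by (simp add: replicate_append_same)
qed auto

lemma action_at_quiet:
  assumes "stays_quiet P n \<omega> t" "s \<le> t" "i < n"
  shows "action_at P n \<omega> s i = quiet_action P s (\<omega> i)"
  using view_at_quiet[OF assms] by (simp add: action_at_def quiet_action_def)

text \<open>A correct end has a lone transmitter and, since \<open>n \<ge> 2\<close>, also a
  listener, who would receive its message.\<close>

lemma not_elects_at_quiet:
  assumes "stays_quiet P n \<omega> t" "n \<ge> 2" "s < t"
  shows "\<not> elects_at P n \<omega> s"
proof
  assume "elects_at P n \<omega> s"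
  then obtain l m where l: "l < n" "action_at P n \<omega> s l = Transmit m"
    and others: "\<And>i. i < n \<Longrightarrow> i \<noteq> l \<Longrightarrow> action_at P n \<omega> s i = Listen"
    by (auto simp: elects_at_def)
  obtain i where i: "i < n" "i \<noteq> l"
    using \<open>n \<ge> 2\<close> by (metis One_nat_def Suc_1 Suc_le_lessD less_trans zero_less_one zero_neq_one)
  have q: "quiet_action P s (\<omega> j) = action_at P n \<omega> s j" if "j < n" for j
    using action_at_quiet[OF assms(1)] that \<open>s < t\<close> by simp
  have "feedback n (\<lambda>j. quiet_action P s (\<omega> j)) i \<noteq> None"
    unfolding feedback_eq_None_iff using l others i q by (metis action.distinct(5))
  then show False
    using assms(1,3) i by (auto simp: stays_quiet_def)
qed

lemma terminated_view_at_mono: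
  assumes "terminated P (\<omega> i) (view_at P n \<omega> s i)" "s \<le> t"
  shows "terminated P (\<omega> i) (view_at P n \<omega> t i)"
  using assms(2)
proof (induction t rule: dec_induct)
  case (step t)
  then show ?case
    unfolding terminated_def by (fastforce simp: le_Suc_eq)
qed (use assms in auto)

text \<open>The leader still transmits in round \<open>t\<close>, so it has not terminated before
  it; as termination is permanent, the time at which all have terminated exceeds
  \<open>t\<close>.\<close>

lemma run_time_ge_elects_at:
  assumes "elects_at P n \<omega> t" "s \<le> t"
  shows "of_nat s \<le> run_time P n \<omega>"
  unfolding run_time_def
proof (rule INF_greatest)
  fix u assume "u \<in> {t. \<forall>i<n. terminated P (\<omega> i) (view_at P n \<omega> t i)}"
  then have u: "terminated P (\<omega> i) (view_at P n \<omega> u i)" if "i < n" for i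
    using that by auto
  obtain l m where "l < n" "action_at P n \<omega> t l = Transmit m"
    using assms(1) by (auto simp: elects_at_def)
  then have "\<not> terminated P (\<omega> l) (view_at P n \<omega> t l)"
    by (auto simp: action_at_def action_of_def)
  then have "t < u"
    using terminated_view_at_mono u[OF \<open>l < n\<close>] by (meson not_le)
  then show "of_nat s \<le> (of_nat u :: ennreal)"
    using assms(2) by (intro of_nat_mono) simp
qed

lemma run_time_quiet:
  assumes "stays_quiet P n \<omega> t" "n \<ge> 2" "elects_at P n \<omega> t'"
  shows "of_nat t \<le> run_time P n \<omega>"
proof -
  have "t \<le> t'"
    using not_elects_at_quiet[OF assms(1,2)] assms(3) by (meson not_le)
  then show ?thesis
    by (rule run_time_ge_elects_at[OF assms(3)])
qed

text \<open>The energy of a run is a maximum over devices, so a single one bounds it from below.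
  Device \<open>0\<close> serves as the representative.\<close>

lemma run_energy_quiet:
  assumes "stays_quiet P n \<omega> t" "n > 0"
  shows "of_nat (quiet_energy P t (\<omega> 0)) \<le> run_energy P n \<omega>"
proof -
  have "of_nat (quiet_energy P t (\<omega> 0)) =
      (\<Sum>s<t. if quiet_action P s (\<omega> 0) = Idle then 0 else 1 :: ennreal)"
    by (simp add: quiet_energy_def sum.If_cases Int_def conj_commute)
  also have "\<dots> = (\<Sum>s<t. if action_at P n \<omega> s 0 = Idle then 0 else 1)"
    using action_at_quiet[OF assms(1)] \<open>n > 0\<close> by (intro sum.cong) auto
  also have "\<dots> \<le> device_energy P n \<omega> 0"
    unfolding device_energy_def by (intro sum_le_suminf) auto
  also have "\<dots> \<le> run_energy P n \<omega>"
    unfolding run_energy_def using \<open>n > 0\<close> by (intro SUP_upper) auto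
  finally show ?thesis .
qed

section \<open>Independence and measurability\<close>

interpretation coin_flips: prob_space coin_flips
  unfolding coin_flips_def by (intro prob_space_PiM measure_pmf.prob_space_axioms)

lemma space_coin_flips [simp]: "space coin_flips = UNIV"
  by (simp add: coin_flips_def space_PiM)

lemma prob_space_runs: "prob_space (runs n)"
  unfolding runs_def by (intro prob_space_PiM coin_flips.prob_space_axioms)

lemma sets_runs_PiE:
  assumes "\<And>i. i < n \<Longrightarrow> X i \<in> sets coin_flips"
  shows "Pi\<^sub>E {..<n} X \<in> sets (runs n)"
  unfolding runs_def using assms by (intro sets_PiM_I_finite) auto

lemma measure_runs_PiE:
  assumes "\<And>i. i < n \<Longrightarrow> X i \<in> sets coin_flips"
  shows "measure (runs n) (Pi\<^sub>E {..<n} X) = (\<Prod>i<n. measure coin_flips (X i))"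
proof -
  interpret finite_product_prob_space "\<lambda>_::nat. coin_flips" "{..<n}"
    by unfold_locales auto
  show ?thesis
    unfolding runs_def using assms by (intro finite_measure_PiM_emb) auto
qed

lemma measurable_quiet_action [measurable]:
  assumes "measurable_protocol P"
  shows "quiet_action P s \<in> measurable coin_flips (count_space UNIV)"
proof -
  have [measurable]: "(\<lambda>b. act P b h) \<in> measurable coin_flips (count_space UNIV)"
    "(\<lambda>b. verdict P b h) \<in> measurable coin_flips (count_space UNIV)" for h
    using assms by (auto simp: measurable_protocol_def)
  show ?thesis
    unfolding quiet_action_def action_of_def terminated_def by measurable
qed

lemma sets_transmitting: "measurable_protocol P \<Longrightarrow> transmitting P s \<in> sets coin_flips"
  using measurable_sets[OF measurable_quiet_action, of P "range Transmit" s]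
  by (simp add: transmitting_def vimage_def image_def)

lemma sets_listening: "measurable_protocol P \<Longrightarrow> listening P s \<in> sets coin_flips"
  using measurable_sets[OF measurable_quiet_action, of P "{Listen}" s]
  by (simp add: listening_def vimage_def)

section \<open>Random prohibitions, the bound on time, and the tail of the quiet energy\<close>

lemma half_power_quiet_energy:
  "(1/2) ^ quiet_energy P t b =
     (\<Prod>s<t. indicator (- transmitting P s) b / 2 + indicator (- listening P s) b / 2 :: real)"
proof -
  \<comment> \<open>Each factor is the chance that a fair coin permits the action of that round: 1
    if idle, otherwise 1/2.\<close>
  have "(\<Prod>s<t. indicator (- transmitting P s) b / 2 + indicator (- listening P s) b / 2 :: real) =
        (\<Prod>s<t. if quiet_action P s b \<noteq> Idle then 1/2 else 1)"
    by (intro prod.cong refl, case_tac "quiet_action P x b")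
       (auto simp: transmitting_def listening_def)
  also have "\<dots> = (1/2) ^ quiet_energy P t b"
    by (simp add: prod.If_cases quiet_energy_def Int_def conj_commute)
  finally show ?thesis ..
qed

definition quiet_weight :: "protocol \<Rightarrow> nat \<Rightarrow> real" where
  "quiet_weight P t = (\<integral>b. (1/2) ^ quiet_energy P t b \<partial>coin_flips)"

lemma quiet_weight_nonneg: "0 \<le> quiet_weight P t"
  by (simp add: quiet_weight_def)

text \<open>\<open>C\<close> is the set of the rounds in which transmitting is forbidden; in the others listening is.\<close>

definition muted :: "protocol \<Rightarrow> nat \<Rightarrow> nat set \<Rightarrow> bits set" where
  "muted P t C = (\<Inter>s\<in>C. - transmitting P s) \<inter> (\<Inter>s\<in>{..<t} - C. - listening P s)"

lemma sets_muted:
  assumes "measurable_protocol P" "C \<subseteq> {..<t}"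
  shows "muted P t C \<in> sets coin_flips"
proof -
  have *: "finite C" using assms(2) finite_subset by blast
  have "- transmitting P s \<in> sets coin_flips" "- listening P s \<in> sets coin_flips" for s
    using sets.compl_sets[OF sets_transmitting[OF assms(1), of s]]
      sets.compl_sets[OF sets_listening[OF assms(1), of s]] by (auto simp: Compl_eq_Diff_UNIV)
  then have "(\<lambda>b. b \<in> muted P t C) \<in> measurable coin_flips (count_space UNIV)"
    unfolding muted_def using * by measurable
  then show ?thesis
    by (simp add: pred_def)
qed

lemma indicator_INT_eq_prod:
  "finite I \<Longrightarrow> indicator (\<Inter>i\<in>I. X i) x = (\<Prod>i\<in>I. indicator (X i) x :: real)"
  by (induction I rule: finite_induct) (auto simp: indicator_inter_arith split: split_indicator)

text \<open>Multiplying out the product of \<open>half_power_quiet_energy\<close> shows that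
  \<open>quiet_weight P t\<close> is the average of the measures of \<open>muted P t C\<close> over
  all \<open>2 ^ t\<close> sets \<open>C\<close>; some \<open>C\<close> reaches the average.\<close>

lemma exists_muted:
  assumes P: "measurable_protocol P"
  obtains C where "C \<subseteq> {..<t}"
    "quiet_weight P t \<le> measure coin_flips (muted P t C)"
proof -
  let ?I = "Pow {..<t}"
  have eq: "(1/2) ^ quiet_energy P t b = (\<Sum>C\<in>?I. indicator (muted P t C) b / 2 ^ t :: real)" for b
  proof -
    have "(1/2::real) ^ quiet_energy P t b =
        (\<Sum>C\<in>?I. (\<Prod>s\<in>C. indicator (- transmitting P s) b / 2) *
          (\<Prod>s\<in>{..<t} - C. indicator (- listening P s) b / 2))"
      unfolding half_power_quiet_energy by (rule prod_add) simp
    also have "\<dots> = (\<Sum>C\<in>?I. indicator (muted P t C) b / 2 ^ t)"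
    proof (intro sum.cong refl)
      fix C assume "C \<in> ?I"
      then have C: "finite C" "C \<subseteq> {..<t}"
        using finite_subset by auto
      have "2 ^ card C * 2 ^ card ({..<t} - C) = (2 ^ t :: real)"
        using C card_mono[OF _ C(2)] by (simp add: card_Diff_subset flip: power_add)
      then show "(\<Prod>s\<in>C. indicator (- transmitting P s) b / 2) *
          (\<Prod>s\<in>{..<t} - C. indicator (- listening P s) b / 2) =
          indicator (muted P t C) b / (2 ^ t :: real)"
        using C by (simp add: muted_def indicator_inter_arith indicator_INT_eq_prod prod_dividef)
    qed
    finally show ?thesis .
  qed
  have avg: "quiet_weight P t =
      (\<Sum>C\<in>?I. measure coin_flips (muted P t C)) / 2 ^ t"
    unfolding quiet_weight_def eq sum_divide_distrib
    using sets_muted[OF P] by (subst Bochner_Integration.integral_sum) (auto simp: less_top[symmetric])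
  have "\<exists>C\<in>?I. quiet_weight P t \<le> measure coin_flips (muted P t C)"
  proof (rule ccontr)
    assume "\<not> ?thesis"
    then have "measure coin_flips (muted P t C) < quiet_weight P t" if "C \<in> ?I" for C
      using that not_le by blast
    then have "(\<Sum>C\<in>?I. measure coin_flips (muted P t C)) < (\<Sum>C\<in>?I. quiet_weight P t)"
      by (intro sum_strict_mono) auto
    then show False
      using avg by (simp add: card_Pow field_simps)
  qed
  then show ?thesis
    using that by auto
qed

text \<open>All devices share the same \<open>C\<close>, so in each round either nobody transmits or
  nobody listens.\<close>

lemma stays_quiet_muted:
  assumes "\<And>i. i < n \<Longrightarrow> \<omega> i \<in> muted P t C"
  shows "stays_quiet P n \<omega> t"
  unfolding stays_quiet_def
proof (intro allI impI)
  fix s i assume "s < t" "i < n"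
  show "feedback n (\<lambda>j. quiet_action P s (\<omega> j)) i = None"
  proof (cases "s \<in> C")
    case True
    then have "quiet_action P s (\<omega> j) \<noteq> Transmit m" if "j < n" for j m
      using assms[OF that] by (auto simp: muted_def transmitting_def)
    then show ?thesis
      unfolding feedback_eq_None_iff by blast
  next
    case False
    then have "quiet_action P s (\<omega> i) \<noteq> Listen"
      using assms[OF \<open>i < n\<close>] \<open>s < t\<close> by (auto simp: muted_def listening_def)
    then show ?thesis
      unfolding feedback_eq_None_iff by blast
  qed
qed

text \<open>By independence all \<open>n\<close> devices lie in the set of
  \<open>exists_muted\<close> with probability at least \<open>quiet_weight P t ^ n\<close>, and
  then the run lasts at least \<open>t\<close> rounds.\<close>

lemma expected_time_ge:
  assumes P: "measurable_protocol P" "solves_leader_election P n" "n \<ge> 2"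
  shows "ennreal (real t * quiet_weight P t ^ n) \<le> expected_time P n"
proof -
  obtain C where C: "C \<subseteq> {..<t}"
    "quiet_weight P t \<le> measure coin_flips (muted P t C)"
    using exists_muted[OF P(1)] by blast
  interpret R: prob_space "runs n" by (rule prob_space_runs)
  let ?E = "Pi\<^sub>E {..<n} (\<lambda>_. muted P t C)"
  have E: "?E \<in> sets (runs n)"
    using sets_muted[OF P(1) C(1)] by (intro sets_runs_PiE)
  have "quiet_weight P t ^ n \<le> measure (runs n) ?E"
    using sets_muted[OF P(1) C(1)] C(2) by (simp add: measure_runs_PiE power_mono quiet_weight_nonneg)
  then have "ennreal (real t * quiet_weight P t ^ n)
      \<le> ennreal (real t * measure (runs n) ?E)"
    by (intro ennreal_leI mult_left_mono) auto
  also have "\<dots> = of_nat t * emeasure (runs n) ?E"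
    by (simp add: R.emeasure_eq_measure ennreal_mult ennreal_of_nat_eq_real_of_nat)
  also have "\<dots> = (\<integral>\<^sup>+\<omega>. of_nat t * indicator ?E \<omega> \<partial>runs n)"
    using E by (simp add: nn_integral_cmult_indicator)
  also have "\<dots> \<le> expected_time P n"
    unfolding expected_time_def
  \<comment> \<open>The comparison is made almost everywhere because \<open>run_time_quiet\<close>
    needs a run that elects a leader at some time.\<close>
  proof (rule nn_integral_mono_AE)
    show "AE \<omega> in runs n. of_nat t * indicator ?E \<omega> \<le> run_time P n \<omega>"
      using P(2) unfolding solves_leader_election_def
    proof (eventually_elim)
      case (elim \<omega>)
      then show ?case
        using run_time_quiet[OF stays_quiet_muted[of n \<omega> P t C] P(3)]
        by (auto split: split_indicator simp: PiE_mem)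
    qed
  qed
  finally show ?thesis .
qed

text \<open>Markov's inequality for \<open>(1/2) ^ quiet_energy P t b\<close>, which exceeds
  \<open>(1/2) ^ m\<close> exactly when the energy is below \<open>m\<close>.\<close>

lemma prob_quiet_energy_less:
  assumes P: "measurable_protocol P"
  shows "{b. quiet_energy P t b < m} \<in> sets coin_flips"
    and "measure coin_flips {b. quiet_energy P t b < m} \<le>
      2 ^ m * quiet_weight P t"
proof -
  have [measurable]: "(\<lambda>b. (1/2) ^ quiet_energy P t b :: real) \<in> borel_measurable coin_flips"
    unfolding half_power_quiet_energy
    using sets.compl_sets[OF sets_transmitting[OF P]] sets.compl_sets[OF sets_listening[OF P]]
    by (auto simp: Compl_eq_Diff_UNIV intro!: borel_measurable_prod borel_measurable_add
        borel_measurable_divide borel_measurable_indicator)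
  have int: "integrable coin_flips (\<lambda>b. (1/2) ^ quiet_energy P t b :: real)"
    by (intro coin_flips.integrable_const_bound[where B = 1]) (auto simp: power_le_one)
  have eq: "{b. quiet_energy P t b < m} = {b \<in> space coin_flips. (1/2) ^ quiet_energy P t b > (1/2::real) ^ m}"
    by auto
  show meas: "{b. quiet_energy P t b < m} \<in> sets coin_flips"
    unfolding eq by measurable
  have "(1/2) ^ m * measure coin_flips {b. quiet_energy P t b < m} =
      (\<integral>b. (1/2) ^ m * indicator {b. quiet_energy P t b < m} b \<partial>coin_flips)"
    using meas by simp
  also have "\<dots> \<le> quiet_weight P t"
    unfolding quiet_weight_def using int meas
    by (intro integral_mono) (auto split: split_indicator intro!: power_decreasing simp: less_imp_le less_top[symmetric])
  finally show "measure coin_flips {b. quiet_energy P t b < m} \<le>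
      2 ^ m * quiet_weight P t"
    by (simp add: field_simps)
qed

section \<open>The probability \<open>exactly_one n p\<close> of a lone transmitter among
  \<open>n\<close> independent devices, across sizes \<open>2 ^ k\<close>\<close>

definition exactly_one :: "nat \<Rightarrow> real \<Rightarrow> real" where
  "exactly_one n p = real n * p * (1 - p) ^ (n - 1)"

text \<open>The difference on the right splits into \<open>m\<close> terms
  \<open>p * (1 - p) ^ j\<close> with \<open>j \<le> 2 * m - 1\<close>, each at least
  \<open>p * (1 - p) ^ (2 * m - 1)\<close>. This form telescopes when \<open>m\<close> runs through
  the powers of two.\<close>

lemma exactly_one_double_le:
  assumes "0 \<le> p" "p \<le> 1"
  shows "exactly_one (2 * m) p \<le> 2 * ((1 - p) ^ m - (1 - p) ^ (2 * m))"
proof (cases "m = 0")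
  case False
  have "(1 - p) ^ m - (1 - p) ^ (2 * m) = (\<Sum>j\<in>{m..<2*m}. (1 - p) ^ j - (1 - p) ^ Suc j)"
    using sum_Suc_diff'[of m "2 * m" "\<lambda>j. - ((1 - p) ^ j)"] by (simp add: algebra_simps)
  also have "\<dots> \<ge> (\<Sum>j\<in>{m..<2*m}. p * (1 - p) ^ (2 * m - 1))"
  proof (intro sum_mono)
    fix j assume "j \<in> {m..<2*m}"
    then have "(1 - p) ^ (2 * m - 1) \<le> (1 - p) ^ j"
      using assms by (intro power_decreasing) auto
    then have "p * (1 - p) ^ (2 * m - 1) \<le> p * (1 - p) ^ j"
      using assms by (intro mult_left_mono)
    also have "\<dots> = (1 - p) ^ j - (1 - p) ^ Suc j"
      by (simp add: algebra_simps)
    finally show "p * (1 - p) ^ (2 * m - 1) \<le> (1 - p) ^ j - (1 - p) ^ Suc j" .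
  qed
  finally show ?thesis
    by (simp add: exactly_one_def mult.assoc)
qed (simp add: exactly_one_def)

lemma sum_exactly_one_powers_le:
  assumes "0 \<le> p" "p \<le> 1"
  shows "(\<Sum>k\<in>{K..<L}. exactly_one (2 ^ Suc k) p) \<le> 2"
proof (cases "K \<le> L")
  case True
  have "(\<Sum>k\<in>{K..<L}. exactly_one (2 ^ Suc k) p) \<le>
      (\<Sum>k\<in>{K..<L}. 2 * ((1 - p) ^ (2 ^ k) - (1 - p) ^ (2 ^ Suc k)))"
    using exactly_one_double_le[OF assms] by (intro sum_mono) simp
  also have "\<dots> = 2 * (\<Sum>k\<in>{K..<L}. (1 - p) ^ (2 ^ k) - (1 - p) ^ (2 ^ Suc k))"
    by (simp only: sum_distrib_left)
  also have "\<dots> = 2 * ((1 - p) ^ (2 ^ K) - (1 - p) ^ (2 ^ L))"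
    using sum_Suc_diff'[OF True, of "\<lambda>k. - ((1 - p) ^ (2 ^ k))"]
    by simp
  also have "\<dots> \<le> 2 * (1 - 0)"
    using assms by (intro mult_left_mono diff_mono power_le_one zero_le_power) auto
  finally show ?thesis by simp
qed auto

text \<open>Each of the \<open>t\<close> rounds contributes at most 2 over all sizes, so the average
  over \<open>8 * t\<close> exponents is at most 1/4. The lower limit on \<open>k\<close> makes the
  sizes unbounded; the upper one keeps \<open>log 2 k\<close> comparable to
  \<open>log 2 t\<close>.\<close>

lemma exists_quiet_size:
  fixes p :: "nat \<Rightarrow> real"
  assumes "\<And>s. 0 \<le> p s" "\<And>s. p s \<le> 1" "t > 0"
  obtains k where "8 * t < k" "k \<le> 16 * t" "(\<Sum>s<t. exactly_one (2 ^ k) (p s)) \<le> 1/4"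
proof -
  let ?f = "\<lambda>k. \<Sum>s<t. exactly_one (2 ^ Suc k) (p s)"
  have "\<exists>k\<in>{8*t..<16*t}. ?f k \<le> 1/4"
  proof (rule ccontr)
    assume "\<not> ?thesis"
    then have "1/4 < ?f k" if "k \<in> {8*t..<16*t}" for k
      using that not_le by blast
    then have "(\<Sum>k\<in>{8*t..<16*t}. 1/4) < sum ?f {8*t..<16*t}"
      using \<open>t > 0\<close> by (intro sum_strict_mono) simp_all
    also have "\<dots> = (\<Sum>s<t. \<Sum>k\<in>{8*t..<16*t}. exactly_one (2 ^ Suc k) (p s))"
      by (rule sum.swap)
    also have "\<dots> \<le> (\<Sum>s<t. 2)"
      by (intro sum_mono sum_exactly_one_powers_le assms)
    finally show False
      by simp
  qed
  then obtain k where "k \<in> {8*t..<16*t}" "?f k \<le> 1/4" ..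
  then show ?thesis
    using that[of "Suc k"] by simp
qed

section \<open>The bound on energy at a quiet size\<close>

lemma not_stays_quietD:
  assumes "\<not> stays_quiet P n \<omega> t"
  obtains s j where "s < t" "j < n" "\<omega> j \<in> transmitting P s"
    "\<And>i. i < n \<Longrightarrow> i \<noteq> j \<Longrightarrow> \<omega> i \<notin> transmitting P s"
proof -
  from assms obtain s where "s < t" "\<exists>!j. j < n \<and> (\<exists>m. quiet_action P s (\<omega> j) = Transmit m)"
    unfolding stays_quiet_def feedback_eq_None_iff by blast
  with that show ?thesis
    unfolding transmitting_def by blast
qed

text \<open>Two bad events have probability at most 1/4 each: some round has a lone transmitter, or
  device \<open>0\<close> has quiet energy below \<open>m\<close>. Outside both, the run costs at
  least \<open>m\<close>, whence \<open>m / 2\<close>.\<close>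

lemma expected_energy_ge:
  assumes P: "measurable_protocol P" and "n > 0"
    and quiet: "(\<Sum>s<t. exactly_one n (measure coin_flips (transmitting P s))) \<le> 1/4"
    and energy: "2 ^ m * quiet_weight P t \<le> 1/4"
  shows "ennreal (real m / 2) \<le> expected_energy P n"
proof -
  interpret R: prob_space "runs n" by (rule prob_space_runs)
  \<comment> \<open>The box of \<open>X s j\<close> says that \<open>j\<close> is the lone
    transmitter of round \<open>s\<close>. Both \<open>B\<close> and \<open>L\<close> are built from
    boxes, whose measures factor.\<close>
  define X where "X s j i = (if i = j then transmitting P s else - transmitting P s)" for s and j i :: nat
  have X [measurable]: "X s j i \<in> sets coin_flips" for s j i
    using sets_transmitting[OF P, of s] sets.compl_sets[OF sets_transmitting[OF P, of s]]
    by (auto simp: X_def Compl_eq_Diff_UNIV)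
  define B where "B = (\<Union>s<t. \<Union>j<n. Pi\<^sub>E {..<n} (X s j))"
  define L where "L = Pi\<^sub>E {..<n} (\<lambda>i. if i = 0 then {b. quiet_energy P t b < m} else UNIV)"
  have XE: "Pi\<^sub>E {..<n} (X s j) \<in> sets (runs n)" for s j
    by (intro sets_runs_PiE X)
  have "UNIV \<in> sets coin_flips"
    using sets.top[of coin_flips] by simp
  note Lm = this prob_quiet_energy_less[OF P, of t m]
  have B: "B \<in> sets (runs n)"
    unfolding B_def using XE by (intro sets.finite_UN) auto
  have L: "L \<in> sets (runs n)"
    unfolding L_def using Lm by (intro sets_runs_PiE) auto
  have "measure (runs n) (Pi\<^sub>E {..<n} (X s j)) =
      measure coin_flips (transmitting P s) * (1 - measure coin_flips (transmitting P s)) ^ (n - 1)"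
    if "j < n" for s j
  proof -
    have "measure (runs n) (Pi\<^sub>E {..<n} (X s j)) = (\<Prod>i<n. measure coin_flips (X s j i))"
      by (intro measure_runs_PiE X)
    also have "\<dots> = measure coin_flips (X s j j) * (\<Prod>i\<in>{..<n} - {j}. measure coin_flips (X s j i))"
      using that by (intro prod.remove) auto
    also have "(\<Prod>i\<in>{..<n} - {j}. measure coin_flips (X s j i)) =
        (\<Prod>i\<in>{..<n} - {j}. 1 - measure coin_flips (transmitting P s))"
      using coin_flips.prob_compl[OF sets_transmitting[OF P]]
      by (intro prod.cong) (auto simp: X_def Compl_eq_Diff_UNIV)
    finally show ?thesis
      using that by (simp add: X_def[of s j j] card_Diff_singleton)
  qed
  then have "(\<Sum>s<t. \<Sum>j<n. measure (runs n) (Pi\<^sub>E {..<n} (X s j))) \<le> 1/4"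
    using quiet by (simp add: exactly_one_def mult.assoc)
  moreover have "measure (runs n) B \<le> (\<Sum>s<t. \<Sum>j<n. measure (runs n) (Pi\<^sub>E {..<n} (X s j)))"
    unfolding B_def using XE
    by (intro order.trans[OF R.finite_measure_subadditive_finite] sum_mono
        R.finite_measure_subadditive_finite) auto
  ultimately have B4: "measure (runs n) B \<le> 1/4" by linarith
  have "measure (runs n) L = (\<Prod>i<n. measure coin_flips (if i = 0 then {b. quiet_energy P t b < m} else UNIV))"
    unfolding L_def using Lm by (intro measure_runs_PiE) auto
  also have "\<dots> = measure coin_flips {b. quiet_energy P t b < m}"
    using \<open>n > 0\<close> coin_flips.prob_space by (subst prod.remove[of _ 0]) auto
  also have "\<dots> \<le> 1/4"
    using Lm(3) energy by linarith
  finally have L4: "measure (runs n) L \<le> 1/4" .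
  define G where "G = space (runs n) - (B \<union> L)"
  have G: "G \<in> sets (runs n)"
    using B L by (auto simp: G_def)
  have "measure (runs n) (B \<union> L) \<le> 1/2"
    using B4 L4 measure_Un_le[OF B L] by linarith
  then have "measure (runs n) G \<ge> 1/2"
    unfolding G_def using B L by (subst R.prob_compl) auto
  then have "ennreal (real m / 2) \<le> ennreal (real m * measure (runs n) G)"
    using mult_left_mono[of "1/2" "measure (runs n) G" "real m"] by (intro ennreal_leI) simp
  also have "\<dots> = of_nat m * emeasure (runs n) G"
    by (simp add: R.emeasure_eq_measure ennreal_mult ennreal_of_nat_eq_real_of_nat)
  also have "\<dots> = (\<integral>\<^sup>+\<omega>. of_nat m * indicator G \<omega> \<partial>runs n)"
    using G by (simp add: nn_integral_cmult_indicator)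
  also have "\<dots> \<le> expected_energy P n"
    unfolding expected_energy_def
  proof (rule nn_integral_mono)
    fix \<omega> assume \<omega>: "\<omega> \<in> space (runs n)"
    show "of_nat m * indicator G \<omega> \<le> run_energy P n \<omega>"
    proof (cases "\<omega> \<in> G")
      case True
      \<comment> \<open>Boxes contain only extensional functions, so membership in \<open>B\<close>
        or \<open>L\<close> requires this.\<close>
      have ext: "\<omega> \<in> extensional {..<n}"
        using \<omega> by (auto simp: runs_def space_PiM PiE_def)
      have "stays_quiet P n \<omega> t"
      proof (rule ccontr)
        assume "\<not> stays_quiet P n \<omega> t"
        then obtain s j where "s < t" "j < n" "\<omega> j \<in> transmitting P s"
          "\<And>i. i < n \<Longrightarrow> i \<noteq> j \<Longrightarrow> \<omega> i \<notin> transmitting P s"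
          using not_stays_quietD by blast
        with ext have "\<omega> \<in> B"
          unfolding B_def X_def by (auto simp: PiE_iff)
        with True show False by (simp add: G_def)
      qed
      moreover have "m \<le> quiet_energy P t (\<omega> 0)"
      proof (rule ccontr)
        assume "\<not> m \<le> quiet_energy P t (\<omega> 0)"
        with ext have "\<omega> \<in> L"
          unfolding L_def by (auto simp: PiE_iff)
        with True show False by (simp add: G_def)
      qed
      ultimately show ?thesis
        using True run_energy_quiet[OF _ \<open>n > 0\<close>] by (auto intro: order.trans[OF of_nat_mono])
    qed simp
  qed
  finally show ?thesis .
qed

section \<open>Choice of parameters\<close>

theorem theorem1p1:
  fixes A :: protocol and nstar :: nat
  assumes "measurable_protocol A"
    and "\<And>n. n \<ge> 2 \<Longrightarrow> solves_leader_election A n"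
    and "nstar \<ge> 2" and "expected_time A nstar < \<infinity>"
  shows "\<exists>c>0. infinite {n. n \<ge> 2 \<and> expected_energy A n \<ge> ennreal (c * log 2 (log 2 (real n)))}"
proof -
  obtain T where T: "expected_time A nstar = ennreal T" "T \<ge> 0"
    using assms(4) by (cases "expected_time A nstar") auto
  obtain d where "T < 2 ^ d"
    using real_arch_pow[of 2 T] by auto
  \<comment> \<open>For \<open>m \<ge> 1\<close>, the exponent
    \<open>4 + nstar * (m + 2) + d\<close> of \<open>16 * t\<close> is at most
    \<open>(4 + 3 * nstar + d) * m\<close>; the factor 2 matches the energy bound
    \<open>m / 2\<close>.\<close>
  define c where "c = 1 / (2 * real (4 + 3 * nstar + d))"
  define S where "S = {n. n \<ge> 2 \<and> expected_energy A n \<ge> ennreal (c * log 2 (log 2 (real n)))}"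
  have "\<exists>n>m. n \<in> S" if "m \<ge> 1" for m
  proof -
    \<comment> \<open>Chosen so that \<open>t * ?e ^ nstar \<le> T < 2 ^ d\<close> forces
      \<open>2 ^ (m + 2) * ?e < 1\<close>, the hypothesis on the weight in
      \<open>expected_energy_ge\<close>.\<close>
    define t :: nat where "t = 2 ^ (nstar * (m + 2) + d)"
    let ?e = "quiet_weight A t"
    have "ennreal (real t * ?e ^ nstar) \<le> ennreal T"
      using expected_time_ge[OF assms(1) assms(2)[OF assms(3)] assms(3), of t] T by simp
    then have "real t * ?e ^ nstar \<le> T"
      using T(2) by simp
    also have "real t = 2 ^ d * (2 ^ (m + 2)) ^ nstar"
      by (simp only: t_def of_nat_power of_nat_numeral flip: power_mult power_add) (simp only: ac_simps)
    also have "2 ^ d * (2 ^ (m + 2)) ^ nstar * ?e ^ nstar = 2 ^ d * (2 ^ (m + 2) * ?e) ^ nstar"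
      by (simp only: power_mult_distrib mult.assoc)
    finally have "2 ^ d * (2 ^ (m + 2) * ?e) ^ nstar < 2 ^ d * 1"
      using \<open>T < 2 ^ d\<close> by linarith
    then have "(2 ^ (m + 2) * ?e) ^ nstar < 1 ^ nstar"
      by (simp only: mult_less_cancel_left_pos zero_less_power zero_less_numeral power_one)
    then have "2 ^ (m + 2) * ?e < 1"
      by (rule power_less_imp_less_base) simp
    then have energy: "2 ^ m * ?e \<le> 1/4"
      by simp
    obtain k where k: "8 * t < k" "k \<le> 16 * t"
      "(\<Sum>s<t. exactly_one (2 ^ k) (measure coin_flips (transmitting A s))) \<le> 1/4"
      by (rule exists_quiet_size[of "\<lambda>s. measure coin_flips (transmitting A s)" t])
         (auto simp: t_def)
    have E: "ennreal (real m / 2) \<le> expected_energy A (2 ^ k)"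
      using expected_energy_ge[OF assms(1) _ k(3) energy] by simp
    have "log 2 (real k) \<le> log 2 (real (16 * t))"
      using k by (intro log_mono) auto
    also have "\<dots> = real (4 + nstar * (m + 2) + d)"
    proof -
      have "real (16 * t) = 2 ^ (4 + nstar * (m + 2) + d)"
        by (simp only: t_def of_nat_mult of_nat_power of_nat_numeral power_add) simp
      then show ?thesis by (simp only: log_pow_cancel)
    qed
    also have "\<dots> \<le> real ((4 + 3 * nstar + d) * m)"
    proof -
      have "4 + 2 * nstar + d \<le> (4 + 2 * nstar + d) * m"
        using that by simp
      then show ?thesis
        unfolding of_nat_le_iff by (simp add: algebra_simps)
    qed
    finally have "c * log 2 (real k) \<le> c * real ((4 + 3 * nstar + d) * m)"
      by (intro mult_left_mono) (auto simp: c_def)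
    also have "\<dots> = real m / 2"
      unfolding c_def of_nat_mult by (simp del: of_nat_add)
    finally have "ennreal (c * log 2 (log 2 (real (2 ^ k)))) \<le> ennreal (real m / 2)"
      by (intro ennreal_leI) simp
    with E have "ennreal (c * log 2 (log 2 (real (2 ^ k)))) \<le> expected_energy A (2 ^ k)"
      by (rule order.trans[rotated])
    \<comment> \<open>The chain \<open>m < t < k < 2 ^ k\<close> makes the sizes found exceed every
      \<open>m\<close>, so there are infinitely many.\<close>
    moreover have "m < 2 ^ k" "(2::nat) \<le> 2 ^ k"
    proof -
      have "1 * m \<le> nstar * (m + 2)"
        using assms(3) by (intro mult_le_mono) auto
      then have "m \<le> nstar * (m + 2) + d"
        by simp
      also have "\<dots> < t"
        unfolding t_def by (rule less_exp)
      finally have "m < k" using k(1) by simp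
      then show "m < 2 ^ k"
        using less_exp by (rule less_trans)
      show "(2::nat) \<le> 2 ^ k"
        using \<open>m < k\<close> by (intro self_le_power) auto
    qed
    ultimately show ?thesis
      unfolding S_def by blast
  qed
  then have "infinite S"
    unfolding infinite_nat_iff_unbounded by (meson le_less_trans le_add2 less_le_trans not_le nle_le)
  moreover have "c > 0"
    by (simp add: c_def)
  ultimately show ?thesis
    unfolding S_def by blast
qed

end
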